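(* Let $\mathcal D_{n,\sigma}=\bigcup_m\mathcal D_{n,m,\sigma}$. Then: (1) for any $n$ and $\sigma\le n-1$, $\log|\mathcal D_{n,\sigma}|\ge n\sigma+(n-\sigma)\log\sigma-(n+\log\sigma)$; (2) for any constant $\varepsilon\in(0,1/2]$, for all $n\ge 2/\varepsilon$ and $\sigma\le(1-\varepsilon)n$, $\log|\mathcal D_{n,\sigma}|\le n\sigma+(n-\sigma)\log\sigma+O(n)$.
   Context: $\log$ is base 2. For a positive integer $k$, $[k]=\{1,\dots,k\}$. A DFA is a triple $D=(Q,\Sigma,\delta)$ with $Q=[n]$, source state $1$, alphabet $\Sigma=[\sigma]$ ordered as integers, and partial transition function $\delta:Q\times\Sigma\to Q$ (not necessarily complete); $m$ is the number of pairs on which $\delta$ is defined. DFAs are assumed to satisfy: state $v$ has at least one incoming transition iff $v>1$; they need not be connected. The alphabet is effective if every letter of $[\sigma]$ labels some transition. A DFA is Wheeler with respect to $1<\dots<n$ if: (i) whenever $u'=\delta(u,a)$, $v'=\delta(v,a')$ and $a<a'$, then $u'<v'$; (ii) whenever $u'=\delta(u,a)\ne\delta(v,a)=v'$ and $u<v$, then $u'<v'$. $\mathcal D_{n,m,\sigma}$ denotes the set of all such WDFAs with states $[n]$, exactly $m$ transitions and effective alphabet $[\sigma]$; thus $\mathcal D_{n,\sigma}$ is the set of all WDFAs with states $[n]$, effective alphabet $[\sigma]$ and Wheeler order $1<\dots<n$, with any number of transitions. The constant in $O(n)$ may depend on $\varepsilon$. *)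

theory Defs
  imports Complex_Main
begin

record dfa =
  states :: "nat set"
  alphabet :: "nat set"
  delta :: "nat \<times> nat \<rightharpoonup> nat"

definition is_dfa :: "nat \<Rightarrow> nat \<Rightarrow> dfa \<Rightarrow> bool" where
  "is_dfa n \<sigma> D \<longleftrightarrow>
     states D = {1..n} \<and> alphabet D = {1..\<sigma>} \<and>
     dom (delta D) \<subseteq> states D \<times> alphabet D \<and> ran (delta D) \<subseteq> states D \<and>
     (\<forall>v\<in>states D. (\<exists>u a. delta D (u, a) = Some v) \<longleftrightarrow> v > 1)"

definition num_transitions :: "dfa \<Rightarrow> nat" where
  "num_transitions D = card (dom (delta D))"

definition effective_alphabet :: "dfa \<Rightarrow> bool" where
  "effective_alphabet D \<longleftrightarrow> (\<forall>a\<in>alphabet D. \<exists>u v. delta D (u, a) = Some v)"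

definition wheeler :: "dfa \<Rightarrow> bool" where
  "wheeler D \<longleftrightarrow>
     (\<forall>u v a a' u' v'. delta D (u, a) = Some u' \<and> delta D (v, a') = Some v' \<and> a < a'
        \<longrightarrow> u' < v') \<and>
     (\<forall>u v a u' v'. delta D (u, a) = Some u' \<and> delta D (v, a) = Some v' \<and> u' \<noteq> v' \<and> u < v
        \<longrightarrow> u' < v')"

definition wdfas_m :: "nat \<Rightarrow> nat \<Rightarrow> nat \<Rightarrow> dfa set" where
  "wdfas_m n m \<sigma> =
     {D. is_dfa n \<sigma> D \<and> num_transitions D = m \<and> effective_alphabet D \<and> wheeler D}"

definition wdfas :: "nat \<Rightarrow> nat \<Rightarrow> dfa set" where
  "wdfas n \<sigma> = (\<Union>m. wdfas_m n m \<sigma>)"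

lemma finite_wdfas: "finite (wdfas n \<sigma>)"
proof -
  let ?A = "{1..n} \<times> {1..\<sigma>}"
  let ?F = "{f. dom f \<subseteq> ?A \<and> ran f \<subseteq> {1..n}}"
  let ?F' = "\<Union>A\<in>Pow ?A. {f. dom f = A \<and> ran f \<subseteq> {1..n}}"
  have "finite ?F'"
    by (intro finite_UN_I finite_set_of_finite_maps) (auto dest: finite_subset)
  moreover have "?F \<subseteq> ?F'" by auto
  ultimately have fin: "finite ?F" by (rule rev_finite_subset)
  have "wdfas n \<sigma> \<subseteq> (\<lambda>f. \<lparr>states = {1..n}, alphabet = {1..\<sigma>}, delta = f\<rparr>) ` ?F"
  proof
    fix D assume "D \<in> wdfas n \<sigma>"
    then have d: "is_dfa n \<sigma> D" by (auto simp: wdfas_def wdfas_m_def)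
    have "D = \<lparr>states = {1..n}, alphabet = {1..\<sigma>}, delta = delta D\<rparr>"
      using d by (cases D) (simp add: is_dfa_def)
    moreover have "delta D \<in> ?F"
    proof -
      have "states D = {1..n}" "alphabet D = {1..\<sigma>}"
        and "dom (delta D) \<subseteq> states D \<times> alphabet D" "ran (delta D) \<subseteq> states D"
        using d unfolding is_dfa_def by blast+
      then show ?thesis by simp
    qed
    ultimately show "D \<in> (\<lambda>f. \<lparr>states = {1..n}, alphabet = {1..\<sigma>}, delta = f\<rparr>) ` ?F"
      by (rule image_eqI)
  qed
  then show ?thesis using fin by (meson finite_imageI finite_subset)
qed

end

theory Submission
  imports Defs
begin

text \<open>
  Order the cells (u, a) of the transition table letter by letter and, within a letter, by state.
  Along the defined cells the targets of a Wheeler DFA run through 2, ..., n without decreasing,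
  so the DFA is determined by its set of defined cells and by its leaders, i.e. the cells at which
  a target occurs for the first time. There are n - 1 leaders, and the first defined cell of each
  letter always is one. With k = n - 1 - \<sigma> the remaining leaders form a k-subset of the table,
  whence at most C(n\<sigma>, k) 2^(n\<sigma> - k) DFAs, and C(n\<sigma>, k) \<le> \<sigma>^k (1 + 1/\<sigma>)^(n\<sigma>) \<le> \<sigma>^k e^n.
  Conversely, if all cells of state 1 are defined, then k leaders and a set of further defined cells
  can be chosen freely in the other n - 1 rows, whence at least
  C((n-1)\<sigma>, k) 2^((n-1)\<sigma> - k) \<ge> \<sigma>^k 2^(n\<sigma> - n + 1) DFAs.
\<close>

section \<open>The cell order, ranks, leaders and column heads\<close>

definition cell_le :: "nat \<times> nat \<Rightarrow> nat \<times> nat \<Rightarrow> bool" where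
  "cell_le c d \<longleftrightarrow> snd c < snd d \<or> snd c = snd d \<and> fst c \<le> fst d"

definition rank :: "(nat \<times> nat) set \<Rightarrow> nat \<times> nat \<Rightarrow> nat" where
  "rank J c = card {d \<in> J. cell_le d c}"

definition leaders :: "(nat \<times> nat \<rightharpoonup> nat) \<Rightarrow> (nat \<times> nat) set" where
  "leaders f = {c \<in> dom f. \<forall>d\<in>dom f. f d = f c \<longrightarrow> cell_le c d}"

text \<open>Only the domain enters, not the targets, so the heads can be recomputed from the set of
  defined cells and need not be recorded in an encoding.\<close>

definition column_heads :: "(nat \<times> nat) set \<Rightarrow> (nat \<times> nat) set" where
  "column_heads P = {(u, a) \<in> P. \<forall>v. (v, a) \<in> P \<longrightarrow> u \<le> v}"

text \<open>The \<open>Suc\<close> turns ranks, which start at 1, into targets, which start at 2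
  because state 1 has no incoming transition.\<close>

definition rank_map :: "(nat \<times> nat) set \<Rightarrow> (nat \<times> nat) set \<Rightarrow> (nat \<times> nat \<rightharpoonup> nat)" where
  "rank_map P J = (\<lambda>c. if c \<in> P then Some (Suc (rank J c)) else None)"

lemma cell_le_refl [simp]: "cell_le c c"
  by (simp add: cell_le_def)

lemma cell_le_trans: "cell_le b c \<Longrightarrow> cell_le c d \<Longrightarrow> cell_le b d"
  by (auto simp: cell_le_def)

lemma cell_le_antisym: "cell_le c d \<Longrightarrow> cell_le d c \<Longrightarrow> c = d"
  by (auto simp: cell_le_def prod_eq_iff)

lemma cell_le_linear: "cell_le c d \<or> cell_le d c"
  by (auto simp: cell_le_def)

lemma finite_has_least_cell:
  assumes "finite A" "A \<noteq> {}"
  shows "\<exists>c\<in>A. \<forall>d\<in>A. cell_le c d"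
  using assms
proof (induction rule: finite_ne_induct)
  case (insert x F)
  then obtain c where "c \<in> F" "\<forall>d\<in>F. cell_le c d" by blast
  then show ?case
    using cell_le_linear[of x c] cell_le_trans[of x c] by auto
qed simp

lemma rank_mono: "finite J \<Longrightarrow> cell_le c d \<Longrightarrow> rank J c \<le> rank J d"
  unfolding rank_def by (rule card_mono) (auto intro: cell_le_trans)

text \<open>The cell \<open>e\<close> is counted at \<open>d\<close> but not at
  \<open>c\<close>.\<close>

lemma rank_less:
  assumes "finite J" "e \<in> J" "cell_le c d" "cell_le e d" "\<not> cell_le e c"
  shows "rank J c < rank J d"
  unfolding rank_def
proof (rule psubset_card_mono)
  show "{x \<in> J. cell_le x c} \<subset> {x \<in> J. cell_le x d}"
    using assms by (auto intro: cell_le_trans)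
qed (use assms in simp)

text \<open>Ranks strictly increase from one member of \<open>J\<close> to the next, so they are
  distinct; since they stay within the right-hand side, equal cardinalities force equality.\<close>

lemma rank_image:
  assumes "finite J"
  shows "rank J ` J = {1..card J}"
proof (rule card_subset_eq)
  show "rank J ` J \<subseteq> {1..card J}"
  proof clarify
    fix u a assume c: "(u, a) \<in> J"
    then have "{(u, a)} \<subseteq> {d \<in> J. cell_le d (u, a)}" by simp
    then have "card {(u, a)} \<le> rank J (u, a)"
      unfolding rank_def using assms by (intro card_mono) auto
    moreover have "rank J (u, a) \<le> card J"
      unfolding rank_def using assms by (intro card_mono) auto
    ultimately show "rank J (u, a) \<in> {1..card J}" by simp
  qed
  have "inj_on (rank J) J"
  proof (rule inj_onI)
    fix c d assume "c \<in> J" "d \<in> J" "rank J c = rank J d"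
    then show "c = d"
      using rank_less[OF assms, of d c d] rank_less[OF assms, of c d c]
        cell_le_linear[of c d] cell_le_antisym[of c d] by auto
  qed
  then show "card (rank J ` J) = card {1..card J}"
    by (simp add: card_image)
qed simp

section \<open>Reconstructing a Wheeler DFA from its domain and its leaders\<close>

locale wdfa =
  fixes n \<sigma> :: nat and D :: dfa
  assumes D: "D \<in> wdfas n \<sigma>"
begin

lemma dom_subset: "dom (delta D) \<subseteq> {1..n} \<times> {1..\<sigma>}"
  and target_in_states: "delta D c = Some v \<Longrightarrow> v \<in> {1..n}"
  and states_eq: "states D = {1..n}"
  and alphabet_eq: "alphabet D = {1..\<sigma>}"
  and has_incoming_iff: "v \<in> {1..n} \<Longrightarrow> (\<exists>u a. delta D (u, a) = Some v) \<longleftrightarrow> v > 1"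
  and effective: "a \<in> {1..\<sigma>} \<Longrightarrow> \<exists>u v. delta D (u, a) = Some v"
  and wheeler_letters: "delta D (u, a) = Some u' \<Longrightarrow> delta D (w, b) = Some w' \<Longrightarrow> a < b \<Longrightarrow> u' < w'"
  and wheeler_states: "delta D (u, a) = Some u' \<Longrightarrow> delta D (w, a) = Some w' \<Longrightarrow> u < w \<Longrightarrow> u' \<le> w'"
proof -
  have dfa: "is_dfa n \<sigma> D" and eff: "effective_alphabet D" and wh: "wheeler D"
    using D by (auto simp: wdfas_def wdfas_m_def)
  show st: "states D = {1..n}" and al: "alphabet D = {1..\<sigma>}"
    using dfa by (auto simp: is_dfa_def)
  show "dom (delta D) \<subseteq> {1..n} \<times> {1..\<sigma>}"
    using dfa unfolding is_dfa_def st al by blast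
  show "delta D c = Some v \<Longrightarrow> v \<in> {1..n}"
    using dfa ranI[of "delta D" c v] unfolding is_dfa_def st by blast
  show "v \<in> {1..n} \<Longrightarrow> (\<exists>u a. delta D (u, a) = Some v) \<longleftrightarrow> v > 1"
    using dfa unfolding is_dfa_def st by blast
  show "a \<in> {1..\<sigma>} \<Longrightarrow> \<exists>u v. delta D (u, a) = Some v"
    using eff unfolding effective_alphabet_def al by blast
  show "delta D (u, a) = Some u' \<Longrightarrow> delta D (w, b) = Some w' \<Longrightarrow> a < b \<Longrightarrow> u' < w'"
    using wh unfolding wheeler_def by blast
  show "delta D (u, a) = Some u' \<Longrightarrow> delta D (w, a) = Some w' \<Longrightarrow> u < w \<Longrightarrow> u' \<le> w'"
    using wh unfolding wheeler_def by (metis order.strict_implies_order order_refl)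
qed

lemma target_bounds:
  assumes "delta D c = Some v"
  shows "v \<in> {2..n}"
  using target_in_states[OF assms] has_incoming_iff[of v] assms by (cases c) (auto simp: Suc_le_eq numeral_2_eq_2)

lemma finite_dom: "finite (dom (delta D))"
  by (rule finite_subset[OF dom_subset]) simp

lemma leaders_subset: "leaders (delta D) \<subseteq> dom (delta D)"
  by (auto simp: leaders_def)

lemma finite_leaders: "finite (leaders (delta D))"
  using finite_dom leaders_subset finite_subset by blast

text \<open>The two Wheeler conditions merge here: the first covers cells with different letters,
  the second covers cells with the same letter.\<close>

lemma target_mono:
  assumes "delta D c = Some v" "delta D d = Some w" "cell_le c d"
  shows "v \<le> w"
proof (cases c; cases d)
  fix u a u' b assume [simp]: "c = (u, a)" "d = (u', b)"
  consider "a < b" | "a = b" "u < u'" | "a = b" "u = u'"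
    using assms(3) by (fastforce simp: cell_le_def)
  then show ?thesis
    using wheeler_letters[of u a v u' b w] wheeler_states[of u a v u' w] assms by cases auto
qed

lemma leader_exists:
  assumes "v \<in> {2..n}"
  shows "\<exists>c\<in>leaders (delta D). delta D c = Some v"
proof -
  let ?A = "{c. delta D c = Some v}"
  have "?A \<noteq> {}" using has_incoming_iff[of v] assms by auto
  moreover have "finite ?A"
    by (rule finite_subset[OF _ finite_dom]) auto
  ultimately obtain c where "c \<in> ?A" "\<forall>d\<in>?A. cell_le c d"
    using finite_has_least_cell by blast
  then have "c \<in> leaders (delta D)" "delta D c = Some v" by (auto simp: leaders_def)
  then show ?thesis by blast
qed

lemma inj_on_leaders: "inj_on (delta D) (leaders (delta D))"
proof (rule inj_onI)
  fix c d assume "c \<in> leaders (delta D)" "d \<in> leaders (delta D)" "delta D c = delta D d"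
  then have "cell_le c d" "cell_le d c" unfolding leaders_def by auto
  then show "c = d" by (rule cell_le_antisym)
qed

lemma delta_leaders_below:
  assumes c: "delta D c = Some v"
  shows "delta D ` {d \<in> leaders (delta D). cell_le d c} = Some ` {2..v}"
proof (intro equalityI subsetI)
  fix y assume "y \<in> delta D ` {d \<in> leaders (delta D). cell_le d c}"
  then obtain d w where d: "cell_le d c" "delta D d = Some w" "y = Some w"
    by (auto simp: leaders_def)
  then show "y \<in> Some ` {2..v}"
    using target_mono[OF d(2) c d(1)] target_bounds[OF d(2)] by auto
next
  fix y assume "y \<in> Some ` {2..v}"
  then obtain w where w: "y = Some w" "2 \<le> w" "w \<le> v" by auto
  then obtain d where d: "d \<in> leaders (delta D)" "delta D d = Some w"
    using leader_exists[of w] target_bounds[OF c] by auto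
  \<comment> \<open>Monotonicity is only weak, so for \<open>w = v\<close> the minimality of the
    leader \<open>d\<close> decides; for \<open>w < v\<close> a position of \<open>d\<close> after
    \<open>c\<close> would force \<open>v \<le> w\<close>.\<close>
  have "cell_le d c"
  proof (cases "w = v")
    case True
    then show ?thesis using d c by (auto simp: leaders_def)
  next
    case False
    then show ?thesis
      using target_mono[OF c d(2)] cell_le_linear[of c d] w by auto
  qed
  then show "y \<in> delta D ` {d \<in> leaders (delta D). cell_le d c}"
    using d w by (auto intro!: image_eqI[of _ _ d])
qed

text \<open>The leaders up to a cell with target \<open>v\<close> correspond one to one to the
  states 2 to \<open>v\<close>, so the rank there is \<open>v - 1\<close>. Hence domain and leaders
  together determine the transition function.\<close>

lemma delta_eq_rank_map: "delta D = rank_map (dom (delta D)) (leaders (delta D))"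
proof
  fix c
  show "delta D c = rank_map (dom (delta D)) (leaders (delta D)) c"
  proof (cases "delta D c")
    case None
    then show ?thesis by (auto simp: rank_map_def)
  next
    case (Some v)
    have "rank (leaders (delta D)) c = card (delta D ` {d \<in> leaders (delta D). cell_le d c})"
      unfolding rank_def
      by (rule card_image[symmetric], rule inj_on_subset[OF inj_on_leaders]) auto
    also have "\<dots> = v - 1"
      unfolding delta_leaders_below[OF Some] by (simp add: card_image)
    finally show ?thesis using Some target_bounds[OF Some] by (auto simp: rank_map_def)
  qed
qed

lemma card_leaders: "card (leaders (delta D)) = n - 1"
proof -
  have "delta D ` leaders (delta D) = Some ` {2..n}"
  proof (intro equalityI subsetI)
    fix y assume "y \<in> delta D ` leaders (delta D)"
    then obtain c v where "delta D c = Some v" "y = Some v" by (auto simp: leaders_def)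
    then show "y \<in> Some ` {2..n}" using target_bounds by blast
  next
    fix y assume "y \<in> Some ` {2..n}"
    then obtain v where "v \<in> {2..n}" "y = Some v" by blast
    then show "y \<in> delta D ` leaders (delta D)" using leader_exists[of v] by force
  qed
  then have "card (leaders (delta D)) = card (Some ` {2..n})"
    using card_image[OF inj_on_leaders] by simp
  then show ?thesis by (simp add: card_image)
qed

text \<open>A smaller letter reaches only strictly smaller targets, so an earlier cell with the same
  target would have to carry the same letter, and there the head comes first.\<close>

lemma column_heads_subset_leaders: "column_heads (dom (delta D)) \<subseteq> leaders (delta D)"
proof clarify
  fix u a assume h: "(u, a) \<in> column_heads (dom (delta D))"
  then obtain v where v: "delta D (u, a) = Some v" by (auto simp: column_heads_def)
  have "cell_le (u, a) (w, b)" if "delta D (w, b) = Some v" for w b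
    using that wheeler_letters[OF that v] h by (force simp: column_heads_def cell_le_def)
  then show "(u, a) \<in> leaders (delta D)" using v by (auto simp: leaders_def)
qed

text \<open>\<open>snd\<close> is a bijection from the heads to the alphabet: a letter has only one
  least source state, and effectiveness gives each letter at least one.\<close>

lemma card_column_heads: "card (column_heads (dom (delta D))) = \<sigma>"
proof -
  have "inj_on snd (column_heads (dom (delta D)))"
  proof (rule inj_onI, clarsimp)
    fix u w a assume "(u, a) \<in> column_heads (dom (delta D))" "(w, a) \<in> column_heads (dom (delta D))"
    then have "u \<le> w" "w \<le> u" unfolding column_heads_def by blast+
    then show "u = w" by simp
  qed
  moreover have "snd ` column_heads (dom (delta D)) = {1..\<sigma>}"
  proof (intro equalityI subsetI)
    fix a assume "a \<in> {1..\<sigma>}"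
    then have ex: "\<exists>u. (u, a) \<in> dom (delta D)" using effective by blast
    let ?u = "LEAST u. (u, a) \<in> dom (delta D)"
    have "(?u, a) \<in> column_heads (dom (delta D))"
      unfolding column_heads_def using LeastI_ex[OF ex] by (auto intro: Least_le)
    then show "a \<in> snd ` column_heads (dom (delta D))" by force
  qed (use dom_subset in \<open>auto simp: column_heads_def\<close>)
  ultimately show ?thesis by (metis card_image card_atLeastAtMost diff_Suc_1)
qed

end

section \<open>Upper bound: encoding a DFA by a set of marked cells and a set of further
  cells\<close>

definition marked_subsets :: "'a set \<Rightarrow> nat \<Rightarrow> ('a set \<times> 'a set) set" where
  "marked_subsets X k = (SIGMA M:{M. M \<subseteq> X \<and> card M = k}. Pow (X - M))"

lemma finite_marked_subsets: "finite X \<Longrightarrow> finite (marked_subsets X k)"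
  unfolding marked_subsets_def by (intro finite_SigmaI) auto

lemma card_marked_subsets:
  assumes "finite X"
  shows "card (marked_subsets X k) = (card X choose k) * 2 ^ (card X - k)"
proof -
  have "card (marked_subsets X k) = (\<Sum>M\<in>{M. M \<subseteq> X \<and> card M = k}. card (Pow (X - M)))"
    unfolding marked_subsets_def using assms by (intro card_SigmaI) auto
  also have "\<dots> = (\<Sum>M\<in>{M. M \<subseteq> X \<and> card M = k}. 2 ^ (card X - k))"
    using assms by (intro sum.cong) (auto simp: card_Pow card_Diff_subset finite_subset)
  finally show ?thesis using n_subsets[OF assms, of k] by simp
qed

text \<open>The marked cells are the leaders that are not column heads. The two components of the
  code unite to the domain; the domain yields the heads, the heads and the marked cells yield the
  leaders, and these determine the DFA.\<close>

lemma card_wdfas_le: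
  "card (wdfas n \<sigma>) \<le> ((n * \<sigma>) choose (n - 1 - \<sigma>)) * 2 ^ (n * \<sigma> - (n - 1 - \<sigma>))"
proof -
  let ?X = "{1..n} \<times> {1..\<sigma>}"
  let ?M = "\<lambda>D. leaders (delta D) - column_heads (dom (delta D))"
  let ?g = "\<lambda>D. (?M D, dom (delta D) - ?M D)"
  have "inj_on ?g (wdfas n \<sigma>)"
  proof (rule inj_onI)
    fix D E assume D: "D \<in> wdfas n \<sigma>" and E: "E \<in> wdfas n \<sigma>" and eq: "?g D = ?g E"
    interpret D: wdfa n \<sigma> D by standard (rule D)
    interpret E: wdfa n \<sigma> E by standard (rule E)
    have dom: "dom (delta D) = dom (delta E)"
      using eq D.leaders_subset E.leaders_subset by blast
    have "leaders (delta D) = ?M D \<union> column_heads (dom (delta D))"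
      using D.column_heads_subset_leaders by auto
    also have "\<dots> = ?M E \<union> column_heads (dom (delta E))"
      using eq unfolding dom by simp
    also have "\<dots> = leaders (delta E)"
      using E.column_heads_subset_leaders by auto
    finally have leaders: "leaders (delta D) = leaders (delta E)" .
    have "delta D = rank_map (dom (delta E)) (leaders (delta E))"
      using D.delta_eq_rank_map unfolding dom leaders .
    also have "\<dots> = delta E" by (rule E.delta_eq_rank_map[symmetric])
    finally have "delta D = delta E" .
    then show "D = E"
      using D.states_eq E.states_eq D.alphabet_eq E.alphabet_eq by (cases D; cases E) simp
  qed
  moreover have "?g ` wdfas n \<sigma> \<subseteq> marked_subsets ?X (n - 1 - \<sigma>)"
  proof (rule image_subsetI)
    fix D assume D: "D \<in> wdfas n \<sigma>"
    interpret D: wdfa n \<sigma> D by standard (rule D)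
    have "card (?M D) = n - 1 - \<sigma>"
      using D.finite_leaders D.column_heads_subset_leaders
      by (simp add: card_Diff_subset finite_subset D.card_leaders D.card_column_heads)
    then show "?g D \<in> marked_subsets ?X (n - 1 - \<sigma>)"
      unfolding marked_subsets_def using D.dom_subset D.leaders_subset by blast
  qed
  ultimately have "card (wdfas n \<sigma>) \<le> card (marked_subsets ?X (n - 1 - \<sigma>))"
    by (intro card_inj_on_le) (auto intro!: finite_marked_subsets)
  then show ?thesis by (simp add: card_marked_subsets)
qed

section \<open>Lower bound: DFAs in which state 1 has a transition for every letter\<close>

definition marked_dfa ::
  "nat \<Rightarrow> nat \<Rightarrow> (nat \<times> nat) set \<times> (nat \<times> nat) set \<Rightarrow> dfa" where
  "marked_dfa n \<sigma> = (\<lambda>(M, R). \<lparr>states = {1..n}, alphabet = {1..\<sigma>},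
     delta = rank_map (M \<union> R \<union> {1} \<times> {1..\<sigma>}) (M \<union> {1} \<times> {1..\<sigma>})\<rparr>)"

lemma dom_rank_map [simp]: "dom (rank_map P J) = P"
  by (auto simp: rank_map_def split: if_splits)

lemma rank_map_eq_Some [simp]: "rank_map P J c = Some v \<longleftrightarrow> c \<in> P \<and> v = Suc (rank J c)"
  by (auto simp: rank_map_def)

lemma marked_subsetsD:
  assumes "(M, R) \<in> marked_subsets ({2..n} \<times> {1..\<sigma>}) (n - 1 - \<sigma>)" and "\<sigma> \<le> n - 1"
  shows "M \<subseteq> {2..n} \<times> {1..\<sigma>}" "R \<subseteq> {2..n} \<times> {1..\<sigma>}" "M \<inter> R = {}"
    "finite (M \<union> {1} \<times> {1..\<sigma>})" "card (M \<union> {1} \<times> {1..\<sigma>}) = n - 1"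
proof -
  show M: "M \<subseteq> {2..n} \<times> {1..\<sigma>}" and "R \<subseteq> {2..n} \<times> {1..\<sigma>}" "M \<inter> R = {}"
    using assms(1) by (auto simp: marked_subsets_def)
  have fin: "finite M" using M by (rule finite_subset) simp
  then show "finite (M \<union> {1} \<times> {1..\<sigma>})" by simp
  have "M \<inter> {1} \<times> {1..\<sigma>} = {}" using M by auto
  then have "card (M \<union> {1} \<times> {1..\<sigma>}) = card M + card ({1::nat} \<times> {1..\<sigma>})"
    using fin by (intro card_Un_disjoint) auto
  then show "card (M \<union> {1} \<times> {1..\<sigma>}) = n - 1"
    using assms by (simp add: marked_subsets_def card_cartesian_product_singleton)
qed

text \<open>Since the whole row of state 1 lies in \<open>J\<close>, each letter starts with a
  member of \<open>J\<close>. So ranks of defined cells are at least 1 and jump between letters, and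
  \<open>J\<close> has the right size for the targets to exhaust 2 to \<open>n\<close>.\<close>

lemma marked_dfa_in_wdfas:
  assumes MR: "(M, R) \<in> marked_subsets ({2..n} \<times> {1..\<sigma>}) (n - 1 - \<sigma>)"
    and \<sigma>: "1 \<le> \<sigma>" "\<sigma> \<le> n - 1"
  shows "marked_dfa n \<sigma> (M, R) \<in> wdfas n \<sigma>"
proof -
  note facts = marked_subsetsD[OF MR \<sigma>(2)]
  define J P where "J = M \<union> {1} \<times> {1..\<sigma>}" and "P = M \<union> R \<union> {1} \<times> {1..\<sigma>}"
  have finJ: "finite J" and cardJ: "card J = n - 1" using facts unfolding J_def by auto
  have P: "P \<subseteq> {1..n} \<times> {1..\<sigma>}" using facts \<sigma> unfolding P_def by force
  have JP: "J \<subseteq> P" by (auto simp: J_def P_def)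
  have head: "(1, a) \<in> J" if "(u, a) \<in> P" for u a
    using that P by (auto simp: J_def)
  have rank_pos: "1 \<le> rank J c" if "c \<in> P" for c
  proof (cases c)
    case (Pair u a)
    then have c: "(1, a) \<in> J" "1 \<le> u" using head that P by auto
    then have "1 \<le> rank J (1, a)" using rank_image[OF finJ] by auto
    also have "\<dots> \<le> rank J c" using c Pair by (intro rank_mono finJ) (simp add: cell_le_def)
    finally show ?thesis .
  qed
  have rank_le: "rank J c \<le> n - 1" for c
    unfolding cardJ[symmetric] rank_def by (intro card_mono finJ) auto
  let ?D = "\<lparr>states = {1..n}, alphabet = {1..\<sigma>}, delta = rank_map P J\<rparr>"
  have "is_dfa n \<sigma> ?D"
    unfolding is_dfa_def
  proof (intro conjI ballI)
    show "ran (delta ?D) \<subseteq> states ?D"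
    proof
      fix v assume "v \<in> ran (delta ?D)"
      then obtain c where "v = Suc (rank J c)" by (auto simp: ran_def)
      then show "v \<in> states ?D" using rank_le[of c] \<sigma> by auto
    qed
  next
    fix v assume v: "v \<in> states ?D"
    show "(\<exists>u a. delta ?D (u, a) = Some v) \<longleftrightarrow> v > 1"
    proof
      assume "\<exists>u a. delta ?D (u, a) = Some v"
      then show "v > 1" using rank_pos by force
    next
      assume "v > 1"
      then have "v - 1 \<in> rank J ` J" unfolding rank_image[OF finJ] cardJ using v by auto
      then obtain u a where "(u, a) \<in> J" "v - 1 = rank J (u, a)" by auto
      then have "(u, a) \<in> P \<and> v = Suc (rank J (u, a))" using JP \<open>v > 1\<close> by auto
      then show "\<exists>u a. delta ?D (u, a) = Some v" by auto
    qed
  qed (use P in simp_all)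
  moreover have "effective_alphabet ?D"
    unfolding effective_alphabet_def by (force simp: P_def)
  moreover have "wheeler ?D"
  proof -
    \<comment> \<open>The separating member of \<open>J\<close> is \<open>(1, b)\<close>: it comes
      after every cell of the smaller letter \<open>a\<close> and no later than
      \<open>(v, b)\<close>.\<close>
    have "rank J (u, a) < rank J (v, b)" if "(u, a) \<in> P" "(v, b) \<in> P" "a < b" for u a v b
      using that head[OF that(2)] P by (intro rank_less[OF finJ, of "(1, b)"]) (auto simp: cell_le_def)
    moreover have "rank J (u, a) \<le> rank J (v, a)" if "u < v" for u v a
      using that by (intro rank_mono finJ) (auto simp: cell_le_def)
    ultimately show ?thesis
      unfolding wheeler_def by (auto simp: le_neq_implies_less)
  qed
  ultimately show ?thesis
    by (auto simp: wdfas_def wdfas_m_def marked_dfa_def J_def P_def)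
qed

text \<open>The rank increases strictly at each member of \<open>J\<close>, so no earlier cell can
  share its value.\<close>

lemma subset_leaders_rank_map:
  assumes "finite J" "J \<subseteq> P"
  shows "J \<subseteq> leaders (rank_map P J)"
proof
  fix c assume c: "c \<in> J"
  have "cell_le c d" if "rank J d = rank J c" for d
    using rank_less[OF assms(1) c, of d c] cell_le_linear[of c d] that by auto
  then show "c \<in> leaders (rank_map P J)"
    using c assms(2) by (auto simp: leaders_def rank_map_def)
qed

text \<open>One inclusion holds for every rank map, and both sides have \<open>n - 1\<close>
  elements.\<close>

lemma leaders_marked_dfa:
  assumes MR: "(M, R) \<in> marked_subsets ({2..n} \<times> {1..\<sigma>}) (n - 1 - \<sigma>)"
    and \<sigma>: "1 \<le> \<sigma>" "\<sigma> \<le> n - 1"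
  shows "leaders (delta (marked_dfa n \<sigma> (M, R))) = M \<union> {1} \<times> {1..\<sigma>}"
proof -
  interpret wdfa n \<sigma> "marked_dfa n \<sigma> (M, R)"
    by standard (rule marked_dfa_in_wdfas[OF assms])
  have "M \<union> {1} \<times> {1..\<sigma>} \<subseteq> leaders (delta (marked_dfa n \<sigma> (M, R)))"
    using subset_leaders_rank_map[OF marked_subsetsD(4)[OF MR \<sigma>(2)], of "M \<union> R \<union> {1} \<times> {1..\<sigma>}"]
    by (auto simp: marked_dfa_def)
  moreover have "card (M \<union> {1} \<times> {1..\<sigma>}) = card (leaders (delta (marked_dfa n \<sigma> (M, R))))"
    using card_leaders marked_subsetsD(5)[OF MR \<sigma>(2)] by simp
  ultimately show ?thesis
    using card_subset_eq[OF finite_leaders] by blast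
qed

text \<open>\<open>M\<close> and \<open>R\<close> avoid the row of state 1, so removing that row
  from the leaders recovers \<open>M\<close>, and removing it and \<open>M\<close> from the domain
  recovers \<open>R\<close>.\<close>

lemma card_wdfas_ge:
  assumes \<sigma>: "1 \<le> \<sigma>" "\<sigma> \<le> n - 1"
  shows "(((n - 1) * \<sigma>) choose (n - 1 - \<sigma>)) * 2 ^ ((n - 1) * \<sigma> - (n - 1 - \<sigma>)) \<le> card (wdfas n \<sigma>)"
proof -
  let ?S = "marked_subsets ({2..n} \<times> {1..\<sigma>}) (n - 1 - \<sigma>)"
  have "inj_on (marked_dfa n \<sigma>) ?S"
  proof (rule inj_onI, clarify)
    fix M R M' R'
    assume S: "(M, R) \<in> ?S" "(M', R') \<in> ?S"
      and eq: "marked_dfa n \<sigma> (M, R) = marked_dfa n \<sigma> (M', R')"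
    have "M \<union> {1} \<times> {1..\<sigma>} = M' \<union> {1} \<times> {1..\<sigma>}"
      using leaders_marked_dfa[OF S(1) \<sigma>] leaders_marked_dfa[OF S(2) \<sigma>] eq by simp
    moreover have "M \<union> R \<union> {1} \<times> {1..\<sigma>} = M' \<union> R' \<union> {1} \<times> {1..\<sigma>}"
      using arg_cong[OF eq, of "\<lambda>D. dom (delta D)"] by (simp add: marked_dfa_def)
    moreover have "({1} \<times> {1..\<sigma>}) \<inter> ({2..n} \<times> {1..\<sigma>}) = {}" by auto
    moreover note marked_subsetsD(1-3)[OF S(1) \<sigma>(2)] marked_subsetsD(1-3)[OF S(2) \<sigma>(2)]
    ultimately have "M = M'" "R = R'" by fast+
    then show "M = M' \<and> R = R'" ..
  qed
  moreover have "marked_dfa n \<sigma> ` ?S \<subseteq> wdfas n \<sigma>"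
    using marked_dfa_in_wdfas[OF _ \<sigma>] by auto
  ultimately have "card ?S \<le> card (wdfas n \<sigma>)"
    using finite_wdfas by (rule card_inj_on_le)
  then show ?thesis by (simp add: card_marked_subsets)
qed

section \<open>Estimates for the binomial coefficient and passage to logarithms\<close>

lemma binomial_mult_le_exp:
  assumes "1 \<le> s"
  shows "real ((n * s) choose k) \<le> real s ^ k * exp (real n)"
proof (cases "k \<le> n * s")
  case True
  \<comment> \<open>With this weight the \<open>k\<close>-th term of the expansion of
    \<open>(x + 1) ^ (n * s)\<close> is the binomial coefficient divided by \<open>s ^ k\<close>,
    while \<open>1 + x \<le> exp x\<close> bounds the whole sum by
    \<open>exp (n * s * x) = exp n\<close>.\<close>
  define x where "x = 1 / real s"
  have x: "x > 0" using assms by (simp add: x_def)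
  have "real ((n * s) choose k) * x ^ k \<le> (\<Sum>j\<le>n * s. real ((n * s) choose j) * x ^ j)"
    by (rule member_le_sum[where f = "\<lambda>j. real ((n * s) choose j) * x ^ j"]) (use True x in auto)
  also have "\<dots> = (x + 1) ^ (n * s)"
    by (simp add: binomial_ring)
  also have "\<dots> \<le> exp x ^ (n * s)"
    using x exp_ge_add_one_self[of x] by (intro power_mono) (auto simp: add.commute)
  also have "\<dots> = exp (real n)"
    using assms by (simp add: x_def flip: exp_of_nat_mult)
  finally show ?thesis
    using assms by (simp add: x_def field_simps)
qed (simp add: binomial_eq_0)

lemma log_card_wdfas_ge:
  assumes \<sigma>: "1 \<le> \<sigma>" "\<sigma> \<le> n - 1"
  shows "real n * real \<sigma> + (real n - real \<sigma>) * log 2 (real \<sigma>) - (real n + log 2 (real \<sigma>))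
    \<le> log 2 (real (card (wdfas n \<sigma>)))"
proof -
  define k where "k = n - 1 - \<sigma>"
  have k: "real k = real n - 1 - real \<sigma>" using \<sigma> by (simp add: k_def of_nat_diff)
  have "n - 1 \<le> (n - 1) * \<sigma>" using \<sigma> by simp
  then have kN: "k \<le> (n - 1) * \<sigma>" unfolding k_def by linarith
  have "real \<sigma> ^ k \<le> (real ((n - 1) * \<sigma>) / real k) ^ k"
  \<comment> \<open>For \<open>k = 0\<close> the quotient divides by zero, but both powers equal 1.
    Otherwise \<open>k \<le> n - 1\<close> puts the quotient above \<open>\<sigma>\<close>.\<close>
  proof (cases "k = 0")
    case False
    have "k * \<sigma> \<le> (n - 1) * \<sigma>" unfolding k_def by (intro mult_right_mono) auto
    then have "real \<sigma> * real k \<le> real ((n - 1) * \<sigma>)"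
      by (metis mult.commute of_nat_le_iff of_nat_mult)
    then show ?thesis using False by (intro power_mono) (auto simp: pos_le_divide_eq)
  qed simp
  also have "\<dots> \<le> real (((n - 1) * \<sigma>) choose k)"
    using kN by (rule binomial_ge_n_over_k_pow_k)
  finally have "real \<sigma> ^ k * 2 ^ ((n - 1) * \<sigma> - k) \<le> real (((n - 1) * \<sigma>) choose k) * 2 ^ ((n - 1) * \<sigma> - k)"
    by simp
  also have "\<dots> = real ((((n - 1) * \<sigma>) choose k) * 2 ^ ((n - 1) * \<sigma> - k))" by simp
  also have "\<dots> \<le> real (card (wdfas n \<sigma>))"
    unfolding of_nat_le_iff k_def by (rule card_wdfas_ge[OF \<sigma>])
  finally have "log 2 (real \<sigma> ^ k * 2 ^ ((n - 1) * \<sigma> - k)) \<le> log 2 (real (card (wdfas n \<sigma>)))"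
    using \<sigma> by (intro log_mono) auto
  moreover have "log 2 (real \<sigma> ^ k * 2 ^ ((n - 1) * \<sigma> - k))
      = real k * log 2 (real \<sigma>) + real ((n - 1) * \<sigma> - k)"
    using \<sigma> by (simp add: log_mult log_nat_power)
  \<comment> \<open>\<open>kN\<close> rules out truncation. Inserting
    \<open>k = n - 1 - \<sigma>\<close> gives \<open>n * \<sigma> - n + 1\<close>, so the claimed
    bound is met with 1 to spare.\<close>
  moreover have "real ((n - 1) * \<sigma> - k) = (real n - 1) * real \<sigma> - real k"
    using kN \<sigma> by (simp add: of_nat_diff)
  ultimately show ?thesis by (simp add: k algebra_simps)
qed

lemma log_card_wdfas_le:
  assumes \<sigma>: "1 \<le> \<sigma>" "\<sigma> < n"
  shows "log 2 (real (card (wdfas n \<sigma>)))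
    \<le> real n * real \<sigma> + (real n - real \<sigma>) * log 2 (real \<sigma>) + log 2 (exp 1) * real n"
proof -
  define k where "k = n - 1 - \<sigma>"
  \<comment> \<open>Monotonicity of \<open>log\<close> requires a positive argument; the lower bound
    on the cardinality supplies it.\<close>
  have pos: "0 < card (wdfas n \<sigma>)"
  proof -
    have "n - 1 \<le> (n - 1) * \<sigma>" using \<sigma> by simp
    then have "n - 1 - \<sigma> \<le> (n - 1) * \<sigma>" by linarith
    then have "0 < (((n - 1) * \<sigma>) choose (n - 1 - \<sigma>)) * 2 ^ ((n - 1) * \<sigma> - (n - 1 - \<sigma>))"
      by simp
    also have "\<dots> \<le> card (wdfas n \<sigma>)" using \<sigma> by (intro card_wdfas_ge) auto
    finally show ?thesis .
  qed
  have "real (card (wdfas n \<sigma>)) \<le> real (((n * \<sigma>) choose k) * 2 ^ (n * \<sigma> - k))"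
    unfolding of_nat_le_iff k_def by (rule card_wdfas_le)
  also have "\<dots> = real ((n * \<sigma>) choose k) * 2 ^ (n * \<sigma> - k)" by simp
  \<comment> \<open>Dropping \<open>k < n\<close> from the exponent of 2 loses fewer than
    \<open>n\<close> bits, which a linear error term can absorb.\<close>
  also have "\<dots> \<le> (real \<sigma> ^ k * exp (real n)) * 2 ^ (n * \<sigma>)"
    using \<sigma> by (intro mult_mono binomial_mult_le_exp power_increasing) auto
  finally have "log 2 (real (card (wdfas n \<sigma>))) \<le> log 2 (real \<sigma> ^ k * exp (real n) * 2 ^ (n * \<sigma>))"
    using pos by (intro log_mono) auto
  also have "\<dots> = real k * log 2 (real \<sigma>) + real n * log 2 (exp 1) + real n * real \<sigma>"
    using \<sigma> by (simp add: log_mult log_nat_power)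
  also have "real k * log 2 (real \<sigma>) \<le> (real n - real \<sigma>) * log 2 (real \<sigma>)"
    using \<sigma> by (intro mult_right_mono) (auto simp: k_def of_nat_diff)
  finally show ?thesis by (simp add: algebra_simps)
qed

theorem theorem20:
  shows "(\<forall>n \<sigma> :: nat. 1 \<le> \<sigma> \<and> \<sigma> \<le> n - 1 \<longrightarrow>
            log 2 (real (card (wdfas n \<sigma>))) \<ge>
              real n * real \<sigma> + (real n - real \<sigma>) * log 2 (real \<sigma>) - (real n + log 2 (real \<sigma>)))
       \<and> (\<forall>\<epsilon> :: real. 0 < \<epsilon> \<and> \<epsilon> \<le> 1 / 2 \<longrightarrow>
            (\<exists>C :: real. \<forall>n \<sigma> :: nat.
               real n \<ge> 2 / \<epsilon> \<and> 1 \<le> \<sigma> \<and> real \<sigma> \<le> (1 - \<epsilon>) * real n \<longrightarrow>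
               log 2 (real (card (wdfas n \<sigma>))) \<le>
                 real n * real \<sigma> + (real n - real \<sigma>) * log 2 (real \<sigma>) + C * real n))"
proof (intro conjI allI impI)
  fix n \<sigma> :: nat assume "1 \<le> \<sigma> \<and> \<sigma> \<le> n - 1"
  then show "log 2 (real (card (wdfas n \<sigma>))) \<ge>
      real n * real \<sigma> + (real n - real \<sigma>) * log 2 (real \<sigma>) - (real n + log 2 (real \<sigma>))"
    by (intro log_card_wdfas_ge) auto
next
  fix \<epsilon> :: real assume \<epsilon>: "0 < \<epsilon> \<and> \<epsilon> \<le> 1 / 2"
  \<comment> \<open>The witness for \<open>C\<close> is \<open>log 2 (exp 1)\<close>, the
    contribution of the factor \<open>exp (real n)\<close>.\<close>
  have "log 2 (real (card (wdfas n \<sigma>))) \<le>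
      real n * real \<sigma> + (real n - real \<sigma>) * log 2 (real \<sigma>) + log 2 (exp 1) * real n"
    if *: "real n \<ge> 2 / \<epsilon> \<and> 1 \<le> \<sigma> \<and> real \<sigma> \<le> (1 - \<epsilon>) * real n" for n \<sigma> :: nat
  proof -
    have "0 < 2 / \<epsilon>" using \<epsilon> by simp
    \<comment> \<open>The threshold on \<open>n\<close> makes \<open>n\<close> positive, so the
      bound \<open>(1 - \<epsilon>) * n\<close> on \<open>\<sigma>\<close> is strictly below
      \<open>n\<close>.\<close>
    then have "0 < \<epsilon> * real n" using * \<epsilon> by (intro mult_pos_pos) linarith+
    then have "real \<sigma> < real n" using * by (simp add: algebra_simps)
    then show ?thesis using * by (intro log_card_wdfas_le) auto
  qed
  then show "\<exists>C :: real. \<forall>n \<sigma> :: nat.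
      real n \<ge> 2 / \<epsilon> \<and> 1 \<le> \<sigma> \<and> real \<sigma> \<le> (1 - \<epsilon>) * real n \<longrightarrow>
      log 2 (real (card (wdfas n \<sigma>))) \<le>
        real n * real \<sigma> + (real n - real \<sigma>) * log 2 (real \<sigma>) + C * real n"
    by blast
qed

end
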